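(* For all $1\le i,j\le N$: $\mathbf{A}^{-1}(i,j)=1$ if and only if $n_i\in R_{0\rightarrow j}$.
   Context: Let $G$ be a finite tree (connected acyclic simple graph) with nodes $n_0,n_1,\dots,n_N$, $N\ge 1$, where $n_0$ is a terminal node (degree one) and the nodes are indexed so that along the path in $G$ from $n_0$ to any node $n_i$ the successively encountered node indices strictly increase. Traveling forward means moving along edges with the node index strictly increasing at each step. Node $n_i$ is forward-adjacent to $n_k$ if $n_i$ and $n_k$ are adjacent and $i<k$. For $j\ge 1$, $R_{0\rightarrow j}$ denotes the (unique) route from $n_0$ to $n_j$ obtained by traveling forward, and $n_i\in R_{0\rightarrow j}$ means that $n_i$ is a node of this route, the terminal nodes $n_0$ and $n_j$ included. The forward adjacency matrix $\mathbf{A}$ of $G$ is the $N\times N$ matrix, with rows and columns indexed by $1,\dots,N$, given by $\mathbf{A}(i,j)=1$ if $i=j$, $\mathbf{A}(i,j)=-1$ if $n_i$ is forward-adjacent to $n_j$, and $\mathbf{A}(i,j)=0$ otherwise. The matrix $\mathbf{A}$ is invertible. *)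

theory Defs
  imports "Graph_Theory.Graph_Theory" "Jordan_Normal_Form.Matrix"
begin

text \<open>
  A finite simple graph is a \<^locale>\<open>pair_graph\<close>: each undirected edge is a pair of opposite arcs.
  The library predicate \<^const>\<open>forest\<close> (hence \<^const>\<open>tree\<close>) counts the closed walk
  \<open>a, b, a\<close> as a cycle, so no symmetric digraph with an edge satisfies it. Cycles of an undirected
  simple graph are the library cycles of length at least three.
\<close>

definition undirected_tree :: "'a pair_pre_digraph \<Rightarrow> bool" where
  "undirected_tree G \<longleftrightarrow>
     pair_graph G \<and>
     Digraph_Component.connected (with_proj G) \<and>
     \<not> (\<exists>p. pre_digraph.cycle (with_proj G) p \<and> 3 \<le> length p)"

text \<open>
  \<open>n\<close> enumerates the nodes as \<open>n 0, \<dots>, n N\<close>. Node lists are written \<open>map n xs\<close> with \<open>xs\<close> the list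
  of indices. In a symmetric digraph the degree of a node is its out-degree.
\<close>

definition indexed_tree :: "'a pair_pre_digraph \<Rightarrow> nat \<Rightarrow> (nat \<Rightarrow> 'a) \<Rightarrow> bool" where
  "indexed_tree G N n \<longleftrightarrow>
     undirected_tree G \<and>
     bij_betw n {0..N} (pverts G) \<and>
     out_degree (with_proj G) (n 0) = 1 \<and>
     (\<forall>xs. xs \<noteq> [] \<and> set xs \<subseteq> {0..N} \<and> hd xs = 0 \<and> vpath (map n xs) (with_proj G)
        \<longrightarrow> sorted_wrt (<) xs)"

definition forward_adjacent :: "'a pair_pre_digraph \<Rightarrow> (nat \<Rightarrow> 'a) \<Rightarrow> nat \<Rightarrow> nat \<Rightarrow> bool" where
  "forward_adjacent G n i k \<longleftrightarrow> (n i, n k) \<in> parcs G \<and> i < k"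

definition is_forward_route ::
  "'a pair_pre_digraph \<Rightarrow> nat \<Rightarrow> (nat \<Rightarrow> 'a) \<Rightarrow> nat \<Rightarrow> 'a list \<Rightarrow> bool" where
  "is_forward_route G N n j p \<longleftrightarrow>
     (\<exists>xs. xs \<noteq> [] \<and> set xs \<subseteq> {0..N} \<and> hd xs = 0 \<and> last xs = j \<and> sorted_wrt (<) xs \<and>
           p = map n xs \<and> vwalk p (with_proj G))"

definition forward_route :: "'a pair_pre_digraph \<Rightarrow> nat \<Rightarrow> (nat \<Rightarrow> 'a) \<Rightarrow> nat \<Rightarrow> 'a list" where
  "forward_route G N n j = (THE p. is_forward_route G N n j p)"

text \<open>
  Matrices in the library are indexed from 0, so the entry at \<open>(i, j)\<close> with \<open>1 \<le> i, j \<le> N\<close> is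
  stored at position \<open>(i - 1, j - 1)\<close>.
\<close>

definition forward_adjacency_matrix ::
  "'a pair_pre_digraph \<Rightarrow> nat \<Rightarrow> (nat \<Rightarrow> 'a) \<Rightarrow> real mat" where
  "forward_adjacency_matrix G N n =
     mat N N (\<lambda>(r, c). if r = c then 1
                       else if forward_adjacent G n (Suc r) (Suc c) then - 1
                       else 0)"

end

(* By the indexing condition every node other than n 0 has exactly one smaller neighbour: if
   a < b < k are both adjacent to k, then the path from n 0 to a followed by k and b visits the
   indices in a non-increasing order.  Hence the route to k is the route to its parent followed
   by k, and for the 0/1 matrix B recording membership in the routes, column k of B minus column
   parent k is the k-th unit vector, that is, B A = 1. *)
theory Submission
  imports Defs "Jordan_Normal_Form.Determinant"
begin

text \<open>Exposes the index list that \<open>is_forward_route\<close> hides under an existential,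
  so that routes can be split and compared as lists of numbers.\<close>

definition increasing_route ::
  "'a pair_pre_digraph \<Rightarrow> nat \<Rightarrow> (nat \<Rightarrow> 'a) \<Rightarrow> nat list \<Rightarrow> nat \<Rightarrow> bool" where
  "increasing_route G N n xs j \<longleftrightarrow>
     xs \<noteq> [] \<and> set xs \<subseteq> {0..N} \<and> hd xs = 0 \<and> last xs = j \<and> sorted_wrt (<) xs \<and>
     vwalk (map n xs) (with_proj G)"

lemma is_forward_route_iff:
  "is_forward_route G N n j p \<longleftrightarrow> (\<exists>xs. increasing_route G N n xs j \<and> p = map n xs)"
  unfolding is_forward_route_def increasing_route_def by blast

lemma vwalk_snoc:
  assumes "p \<noteq> []"
  shows "vwalk (p @ [v]) H \<longleftrightarrow> vwalk p H \<and> v \<in> verts H \<and> (last p, v) \<in> arcs_ends H"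
  using assms by (auto simp: vwalk_def set_vwalk_arcs_snoc)

lemma reachable_imp_vwalk:
  assumes "u \<rightarrow>\<^sup>*\<^bsub>H\<^esub> v"
  shows "\<exists>p. vwalk p H \<and> hd p = u \<and> last p = v"
  using assms unfolding reachable_def
proof (induction rule: rtrancl_on_induct)
  case base
  then have "vwalk [u] H" by (simp add: vwalk_def)
  then show ?case by force
next
  case (step v w)
  then obtain p where p: "vwalk p H" "hd p = u" "last p = v" by blast
  then have "p \<noteq> []" by (simp add: vwalk_def)
  with p step have "vwalk (p @ [w]) H" "hd (p @ [w]) = u" "last (p @ [w]) = w"
    by (simp_all add: vwalk_snoc)
  then show ?case by blast
qed

lemma sorted_wrt_less_le_last:
  fixes xs :: "'b::linorder list"
  assumes "sorted_wrt (<) xs" "x \<in> set xs"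
  shows "x \<le> last xs"
  using assms by (cases xs rule: rev_cases) (auto simp: sorted_wrt_append)

lemma increasing_route_le_last:
  "increasing_route G N n xs j \<Longrightarrow> i \<in> set xs \<Longrightarrow> i \<le> j"
  unfolding increasing_route_def using sorted_wrt_less_le_last by blast

lemma increasing_route_to_0:
  assumes "increasing_route G N n xs 0"
  shows "xs = [0]"
  using assms unfolding increasing_route_def
  by (cases xs) (auto split: if_splits dest!: last_in_set)

text \<open>This recursion along the endpoint drives both the uniqueness of routes and the relation
  between the columns of the inverse.\<close>

lemma increasing_route_last_step:
  assumes "increasing_route G N n xs j" "0 < j"
  shows "\<exists>ys a. xs = ys @ [j] \<and> increasing_route G N n ys a \<and> forward_adjacent G n a j"
proof -
  obtain ys where xs: "xs = ys @ [j]"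
    using assms unfolding increasing_route_def by (metis append_butlast_last_id)
  \<comment> \<open>Otherwise \<open>xs\<close> would be \<open>[j]\<close>, whose head is not
    0.\<close>
  with assms have ys: "ys \<noteq> []"
    unfolding increasing_route_def by auto
  then have "increasing_route G N n ys (last ys)" "forward_adjacent G n (last ys) j"
    using assms unfolding increasing_route_def xs forward_adjacent_def
    by (auto simp: vwalk_snoc sorted_wrt_append last_map)
  with xs show ?thesis by blast
qed

context
  fixes G :: "'a pair_pre_digraph" and N :: nat and n :: "nat \<Rightarrow> 'a"
  assumes tree: "indexed_tree G N n"
begin

interpretation pair_graph G
  using tree by (simp add: indexed_tree_def undirected_tree_def)

lemma inj_nodes: "inj_on n {0..N}" and image_nodes: "n ` {0..N} = pverts G"
  using tree by (auto simp: indexed_tree_def bij_betw_def)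

lemma sorted_if_vpath_from_0:
  assumes "xs \<noteq> []" "set xs \<subseteq> {0..N}" "hd xs = 0" "vpath (map n xs) (with_proj G)"
  shows "sorted_wrt (<) xs"
  using tree assms by (simp add: indexed_tree_def)

text \<open>Connectedness ignores the direction of arcs; as every arc has its opposite, it still
  yields directed reachability.\<close>

lemma reachable_verts:
  assumes "u \<in> pverts G" "v \<in> pverts G"
  shows "u \<rightarrow>\<^sup>*\<^bsub>with_proj G\<^esub> v"
proof -
  have "Digraph_Component.connected (with_proj G)"
    using tree by (simp add: indexed_tree_def undirected_tree_def)
  then have "strongly_connected (with_proj G)"
    using symmetric_connected_imp_strongly_connected sym_arcs by blast
  with assms show ?thesis
    by (simp add: strongly_connected_def)
qed

text \<open>Connectedness gives a walk from \<open>n 0\<close> to \<open>n j\<close>, which shortens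
  to a path; the indexing condition then forces its indices to increase.\<close>

lemma ex_increasing_route:
  assumes "j \<le> N"
  shows "\<exists>xs. increasing_route G N n xs j"
proof -
  have "n 0 \<in> pverts G" "n j \<in> pverts G"
    using image_nodes assms by auto
  then obtain p where "vpath p (with_proj G)" and hd: "hd p = n 0" and last: "last p = n j"
    using reachable_verts reachable_imp_vwalk vwalk_imp_ex_vpath by metis
  then have p: "vpath p (with_proj G)" "p \<noteq> []" "set p \<subseteq> n ` {0..N}"
    by (auto simp: vpath_def vwalk_def image_nodes)
  \<comment> \<open>The path is pulled back along \<open>n\<close> to a list of indices.\<close>
  then have "p \<in> map n ` lists {0..N}"
    by (auto simp flip: lists_image)
  then obtain xs where xs: "p = map n xs" "set xs \<subseteq> {0..N}"
    by auto
  with p have ne: "xs \<noteq> []" by auto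
  have "n (hd xs) = n 0" "n (last xs) = n j"
    using hd last xs ne by (auto simp: hd_map last_map)
  moreover have "hd xs \<in> {0..N}" "last xs \<in> {0..N}"
    using xs(2) ne by (meson hd_in_set last_in_set subsetD)+
  ultimately have "hd xs = 0" "last xs = j"
    using inj_nodes assms by (auto dest: inj_onD)
  then have "increasing_route G N n xs j"
    unfolding increasing_route_def
    using xs ne p sorted_if_vpath_from_0[of xs] by (auto simp: vpath_def)
  then show ?thesis by blast
qed

lemma forward_adjacent_unique_less:
  assumes "forward_adjacent G n a k" "forward_adjacent G n b k" "k \<le> N"
  shows "\<not> a < b"
proof
  assume "a < b"
  have arcs: "(n a, n k) \<in> parcs G" "(n k, n b) \<in> parcs G" and less: "b < k"
    using assms arcs_symmetric by (auto simp: forward_adjacent_def)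
  \<comment> \<open>The route to the smaller neighbour is the one to extend: its indices are at most
    \<open>a\<close>, so appending \<open>k\<close> and \<open>b\<close> repeats no node.\<close>
  obtain xs where xs: "increasing_route G N n xs a"
    using ex_increasing_route \<open>a < b\<close> less assms(3) by fastforce
  let ?ys = "xs @ [k, b]"
  have ne: "xs \<noteq> []" and walk: "vwalk (map n xs) (with_proj G)" and set: "set xs \<subseteq> {0..N}"
    using xs by (auto simp: increasing_route_def)
  have bound: "\<forall>i\<in>set xs. i \<le> a"
    using xs increasing_route_le_last by blast
  have distinct: "distinct xs"
    using xs strict_sorted_iff by (auto simp: increasing_route_def)
  have ys: "set ?ys \<subseteq> {0..N}" "distinct ?ys"
    using set distinct bound \<open>a < b\<close> less assms(3) by auto
  have "last (map n xs) = n a"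
    using xs ne by (simp add: increasing_route_def last_map)
  moreover have "n k \<in> pverts G" "n b \<in> pverts G"
    using arcs by (auto dest: in_arcsD1 in_arcsD2)
  ultimately have "vwalk ((map n xs @ [n k]) @ [n b]) (with_proj G)"
    using walk ne arcs by (subst vwalk_snoc, simp, subst vwalk_snoc, simp_all)
  moreover have "distinct (map n ?ys)"
    using ys inj_nodes inj_on_subset unfolding distinct_map by blast
  ultimately have "vpath (map n ?ys) (with_proj G)"
    by (simp add: vpath_def)
  then have "sorted_wrt (<) ?ys"
    using sorted_if_vpath_from_0[of ?ys] ys xs ne by (simp add: increasing_route_def)
  \<comment> \<open>Sortedness of the extended list would require \<open>k < b\<close>.\<close>
  with less show False
    by (simp add: sorted_wrt_append)
qed

lemma forward_adjacent_unique:
  assumes "forward_adjacent G n a k" "forward_adjacent G n b k" "k \<le> N"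
  shows "a = b"
  using forward_adjacent_unique_less[OF assms] forward_adjacent_unique_less[OF assms(2,1,3)]
  by simp

text \<open>The last step must come from the only smaller neighbour of \<open>j\<close>, so
  induction on the endpoint applies. Together with existence this makes the \<open>THE\<close> in
  \<open>forward_route\<close> well defined.\<close>

lemma increasing_route_unique:
  assumes "increasing_route G N n xs j" "increasing_route G N n ys j"
  shows "xs = ys"
  using assms
proof (induction j arbitrary: xs ys rule: less_induct)
  case (less j)
  show ?case
  proof (cases "j = 0")
    case True
    with less.prems show ?thesis using increasing_route_to_0 by metis
  next
    case False
    have "j \<le> N"
      using less.prems(1) unfolding increasing_route_def by (metis atLeastAtMost_iff last_in_set subsetD)
    obtain xs' a where x: "xs = xs' @ [j]" "increasing_route G N n xs' a" "forward_adjacent G n a j"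
      using increasing_route_last_step[OF less.prems(1)] False by auto
    obtain ys' b where y: "ys = ys' @ [j]" "increasing_route G N n ys' b" "forward_adjacent G n b j"
      using increasing_route_last_step[OF less.prems(2)] False by auto
    have "a = b" "a < j"
      using forward_adjacent_unique x y \<open>j \<le> N\<close> by (auto simp: forward_adjacent_def)
    with less.IH x y show ?thesis by blast
  qed
qed

lemma forward_route_eq:
  assumes "increasing_route G N n xs j"
  shows "forward_route G N n j = map n xs"
  unfolding forward_route_def is_forward_route_iff
  using assms increasing_route_unique by blast

text \<open>Injectivity of \<open>n\<close> on the index range transfers membership from nodes to
  indices.\<close>

lemma in_forward_route_iff:
  assumes "increasing_route G N n xs j" "i \<le> N"
  shows "n i \<in> set (forward_route G N n j) \<longleftrightarrow> i \<in> set xs"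
proof -
  have "set xs \<subseteq> {0..N}"
    using assms by (simp add: increasing_route_def)
  then show ?thesis
    using assms inj_on_image_mem_iff[OF inj_nodes, of i "set xs"] by (simp add: forward_route_eq)
qed

lemma forward_route_0: "i \<le> N \<Longrightarrow> n i \<in> set (forward_route G N n 0) \<longleftrightarrow> i = 0"
  using ex_increasing_route[of 0] increasing_route_to_0 in_forward_route_iff by fastforce

text \<open>Here \<open>a\<close> is the parent of \<open>j\<close>. The first clause locates the
  only possible -1 in column \<open>j\<close>, the second compares the columns of \<open>j\<close>
  and \<open>a\<close>, and the third makes their difference 1 at row \<open>j\<close>.\<close>

lemma forward_route_step:
  assumes "0 < j" "j \<le> N"
  shows "\<exists>a<j. (\<forall>k. forward_adjacent G n k j \<longleftrightarrow> k = a) \<and>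
    (\<forall>i\<le>N. n i \<in> set (forward_route G N n j) \<longleftrightarrow> i = j \<or> n i \<in> set (forward_route G N n a)) \<and>
    n j \<notin> set (forward_route G N n a)"
proof -
  obtain xs where xs: "increasing_route G N n xs j"
    using ex_increasing_route assms by blast
  then obtain ys a where a: "xs = ys @ [j]" "increasing_route G N n ys a" "forward_adjacent G n a j"
    using increasing_route_last_step assms by blast
  have "a < j" using a by (simp add: forward_adjacent_def)
  moreover have "\<forall>k. forward_adjacent G n k j \<longleftrightarrow> k = a"
    using a(3) forward_adjacent_unique assms by blast
  moreover have "j \<notin> set ys"
    using increasing_route_le_last[OF a(2)] \<open>a < j\<close> by fastforce
  ultimately show ?thesis
    using in_forward_route_iff[OF xs] in_forward_route_iff[OF a(2)] a(1) assms
    by (intro exI[of _ a]) auto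
qed

definition route_matrix :: "real mat" where
  "route_matrix =
     mat N N (\<lambda>(r, c). of_bool (n (Suc r) \<in> set (forward_route G N n (Suc c))))"

text \<open>The product is taken in this order because a column of the forward adjacency matrix has
  at most two nonzero entries, at the node itself and at its parent, whereas a row has one for every
  child.\<close>

lemma route_matrix_mult: "route_matrix * forward_adjacency_matrix G N n = 1\<^sub>m N"
proof (rule eq_matI)
  fix r c assume "r < dim_row (1\<^sub>m N :: real mat)" "c < dim_col (1\<^sub>m N :: real mat)"
  then have rc: "r < N" "c < N" by simp_all
  define R where "R j = (of_bool (n (Suc r) \<in> set (forward_route G N n j)) :: real)" for j
  obtain a where a: "a < Suc c" "\<And>k. forward_adjacent G n k (Suc c) \<longleftrightarrow> k = a"
    "\<And>i. i \<le> N \<Longrightarrow> n i \<in> set (forward_route G N n (Suc c)) \<longleftrightarrow>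
        i = Suc c \<or> n i \<in> set (forward_route G N n a)"
    "n (Suc c) \<notin> set (forward_route G N n a)"
    using forward_route_step[of "Suc c"] rc by auto
  \<comment> \<open>Node \<open>n 0\<close> has no row or column in the matrices; this value lets a
    parent \<open>a = 0\<close> be treated like any other.\<close>
  have R0: "R 0 = 0"
    using forward_route_0[of "Suc r"] rc by (simp add: R_def)
  have "(route_matrix * forward_adjacency_matrix G N n) $$ (r, c) =
      (\<Sum>k<N. R (Suc k) * (if k = c then 1 else if Suc k = a then - 1 else 0))"
    using rc by (simp add: route_matrix_def forward_adjacency_matrix_def scalar_prod_def R_def a(2)
        lessThan_atLeast0 cong: if_cong)
  \<comment> \<open>The two conditions exclude each other, since \<open>a < Suc c\<close>.\<close>
  also have "\<dots> = (\<Sum>k<N. (if k = c then R (Suc k) else 0) - (if Suc k = a then R (Suc k) else 0))"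
    using a(1) by (intro sum.cong) auto
  also have "\<dots> = R (Suc c) - (\<Sum>k<N. if Suc k = a then R (Suc k) else 0)"
    using rc by (simp add: sum_subtractf)
  \<comment> \<open>For \<open>a = 0\<close> no summand survives and \<open>R0\<close>
    applies.\<close>
  also have "(\<Sum>k<N. if Suc k = a then R (Suc k) else 0) = R a"
    using R0 a(1) rc by (cases a) simp_all
  also have "R (Suc c) - R a = 1\<^sub>m N $$ (r, c)"
    using a(3)[of "Suc r"] a(4) rc by (auto simp: R_def)
  finally show "(route_matrix * forward_adjacency_matrix G N n) $$ (r, c) = 1\<^sub>m N $$ (r, c)" .
qed (simp_all add: route_matrix_def forward_adjacency_matrix_def)

lemma ex_inverse_forward_adjacency_matrix:
  "\<exists>B. inverts_mat (forward_adjacency_matrix G N n) B \<and>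
       inverts_mat B (forward_adjacency_matrix G N n) \<and>
       (\<forall>i\<in>{1..N}. \<forall>j\<in>{1..N}.
          B $$ (i - 1, j - 1) = 1 \<longleftrightarrow> n i \<in> set (forward_route G N n j))"
proof (intro exI conjI ballI)
  have A: "forward_adjacency_matrix G N n \<in> carrier_mat N N" and B: "route_matrix \<in> carrier_mat N N"
    by (simp_all add: forward_adjacency_matrix_def route_matrix_def)
  show "inverts_mat route_matrix (forward_adjacency_matrix G N n)"
    using route_matrix_mult B by (simp add: inverts_mat_def)
  \<comment> \<open>For square matrices over a field, a left inverse is also a right
    inverse.\<close>
  show "inverts_mat (forward_adjacency_matrix G N n) route_matrix"
    using mat_mult_left_right_inverse[OF B A route_matrix_mult] A by (simp add: inverts_mat_def)
  show "route_matrix $$ (i - 1, j - 1) = 1 \<longleftrightarrow> n i \<in> set (forward_route G N n j)"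
    if "i \<in> {1..N}" "j \<in> {1..N}" for i j
    using that by (cases i; cases j) (auto simp: route_matrix_def)
qed

end

theorem theorem13:
  fixes G :: "'a pair_pre_digraph" and N :: nat and n :: "nat \<Rightarrow> 'a"
  assumes "N \<ge> 1"
    and "indexed_tree G N n"
  shows "\<exists>B. inverts_mat (forward_adjacency_matrix G N n) B \<and>
             inverts_mat B (forward_adjacency_matrix G N n) \<and>
             (\<forall>i\<in>{1..N}. \<forall>j\<in>{1..N}.
                B $$ (i - 1, j - 1) = 1 \<longleftrightarrow> n i \<in> set (forward_route G N n j))"
  using ex_inverse_forward_adjacency_matrix[OF assms(2)] .

end
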